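(* There exists a countable set $\Xi\subset(0,\infty)$ such that $L_\beta^1=\emptyset$ for all $\beta\in(0,\infty)\setminus\Xi$.
   Context: For $\beta>0$, an integer $p\ge2$ and $x\in[0,1]$ let $H_{\beta,p}(x)=\beta x^p-\frac12\{(1+x)\log(1+x)+(1-x)\log(1-x)\}$, with the convention $0\log 0=0$. Define $\beta^*(p)=\sup\{\beta>0:\sup_{x\in[0,1]}H_{\beta,p}(x)=0\}$, and let $m_*(\beta,q)$ be the largest non-negative global maximizer of $H_{\beta,q}$ on $[0,1]$. For $\beta>0$ let $L_\beta=\{p\ge2 \text{ integer}:\beta^*(p)<\beta\}$ and $L_\beta^1=\{p\in L_\beta:\exists\, q\in L_\beta,\ q\neq p,\ m_*(\beta,q)=m_*(\beta,p)\}$. *)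

theory Defs
  imports Complex_Main "HOL-Library.Countable_Set"
begin

text \<open>The convention \<open>0 log 0 = 0\<close> at \<open>x = 1\<close> holds automatically because of the factor \<open>0\<close>.\<close>

definition H :: "real \<Rightarrow> nat \<Rightarrow> real \<Rightarrow> real" where
  "H \<beta> p x = \<beta> * x ^ p - 1/2 * ((1 + x) * ln (1 + x) + (1 - x) * ln (1 - x))"

definition beta_star :: "nat \<Rightarrow> real" where
  "beta_star p = Sup {\<beta>. \<beta> > 0 \<and> (SUP x\<in>{0..1}. H \<beta> p x) = 0}"

definition m_star :: "real \<Rightarrow> nat \<Rightarrow> real" where
  "m_star \<beta> q = (GREATEST m. m \<in> {0..1} \<and> (\<forall>x\<in>{0..1}. H \<beta> q x \<le> H \<beta> q m))"

definition L :: "real \<Rightarrow> nat set" where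
  "L \<beta> = {p. p \<ge> 2 \<and> beta_star p < \<beta>}"

definition L1 :: "real \<Rightarrow> nat set" where
  "L1 \<beta> = {p \<in> L \<beta>. \<exists>q \<in> L \<beta>. q \<noteq> p \<and> m_star \<beta> q = m_star \<beta> p}"

end

(* Above the threshold, m_star is an interior critical point of H, so
   beta * p * m^(p-1) = artanh m.  If the same m is critical for two exponents p < q, then
   p * m^(p-1) = q * m^(q-1), which determines m from (p, q), and then beta is determined
   as well.  Hence each of the countably many pairs (p, q) excludes at most one beta. *)
theory Submission
  imports Defs "HOL-Real_Asymp.Real_Asymp"
begin

text \<open>Only t = 0 is delicate: there the one-sided limit 0 agrees with the value
  \<open>0 * ln 0 = 0\<close>. This gives continuity of the entropy up to the endpoint x =
  1.\<close>

lemma continuous_on_mult_ln: "continuous_on {0..} (\<lambda>t::real. t * ln t)"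
  unfolding continuous_on_eq_continuous_within
proof
  fix t :: real assume "t \<in> {0..}"
  show "continuous (at t within {0..}) (\<lambda>t. t * ln t)"
  proof (cases "t = 0")
    case True
    have "((\<lambda>t::real. t * ln t) \<longlongrightarrow> 0) (at_right 0)"
      by real_asymp
    moreover have "at 0 within {0..} = at_right (0::real)"
      by (auto simp: at_within_def intro!: arg_cong2[where f = inf] arg_cong[where f = principal])
    ultimately show ?thesis
      using True by (simp add: continuous_within)
  next
    case False
    then show ?thesis by (intro continuous_intros) auto
  qed
qed

lemma continuous_on_H: "continuous_on {0..1} (H \<beta> p)"
proof -
  have "continuous_on {0..1} (\<lambda>x::real. (1 + x) * ln (1 + x))"
    by (rule continuous_on_compose2[OF continuous_on_mult_ln]) (auto intro!: continuous_intros)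
  moreover have "continuous_on {0..1} (\<lambda>x::real. (1 - x) * ln (1 - x))"
    by (rule continuous_on_compose2[OF continuous_on_mult_ln]) (auto intro!: continuous_intros)
  ultimately have "continuous_on {0..1}
      (\<lambda>x::real. 1/2 * ((1 + x) * ln (1 + x) + (1 - x) * ln (1 - x)))"
    by (rule continuous_on_mult_left[OF continuous_on_add])
  moreover have "continuous_on {0..1} (\<lambda>x. \<beta> * x ^ p)"
    by (intro continuous_intros)
  ultimately show ?thesis
    unfolding H_def by (rule continuous_on_diff[rotated])
qed

lemma H_attains_max:
  obtains a where "a \<in> {0..1}" "\<And>x. x \<in> {0..1} \<Longrightarrow> H \<beta> p x \<le> H \<beta> p a"
  using continuous_attains_sup[OF compact_Icc _ continuous_on_H]
  by (metis atLeastatMost_empty_iff zero_less_one_class.zero_le_one)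

lemma bdd_above_H: "bdd_above (H \<beta> p ` {0..1})"
  by (metis H_attains_max bdd_aboveI2)

lemma H_0: "p \<ge> 2 \<Longrightarrow> H \<beta> p 0 = 0"
  by (simp add: H_def)

text \<open>\<open>GREATEST\<close> is informative only if a greatest element exists. The maximizers
  form a level set of a continuous function on a compact interval, hence a nonempty compact set,
  which has one.\<close>

lemma m_star_maximizer:
  shows "m_star \<beta> p \<in> {0..1}" and "\<And>x. x \<in> {0..1} \<Longrightarrow> H \<beta> p x \<le> H \<beta> p (m_star \<beta> p)"
proof -
  define M where "M = {m. m \<in> {0..1} \<and> (\<forall>x\<in>{0..1}. H \<beta> p x \<le> H \<beta> p m)}"
  obtain a where a: "a \<in> {0..1}" "\<And>x. x \<in> {0..1} \<Longrightarrow> H \<beta> p x \<le> H \<beta> p a"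
    using H_attains_max[of \<beta> p] by blast
  have "M = H \<beta> p -` {H \<beta> p a} \<inter> {0..1}"
  proof (intro subset_antisym subsetI)
    show "m \<in> H \<beta> p -` {H \<beta> p a} \<inter> {0..1}" if "m \<in> M" for m
      using that a(1) a(2)[of m] unfolding M_def by (simp add: order.antisym)
    show "m \<in> M" if "m \<in> H \<beta> p -` {H \<beta> p a} \<inter> {0..1}" for m
      using that a(2) unfolding M_def by simp
  qed
  then have "closed M"
    using continuous_on_closed_vimage[of "{0..1}" "H \<beta> p"] continuous_on_H[of \<beta> p] by simp
  moreover have "M = {0..1} \<inter> M" by (auto simp: M_def)
  ultimately have "compact M"
    by (metis compact_Icc compact_Int_closed)
  moreover have "M \<noteq> {}" using a by (auto simp: M_def)
  ultimately obtain g where g: "g \<in> M" "\<forall>m\<in>M. m \<le> g"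
    using compact_attains_sup[of M] by blast
  have "m_star \<beta> p = (GREATEST m. m \<in> M)"
    unfolding m_star_def M_def mem_Collect_eq ..
  also have "\<dots> = g"
    using g by (intro Greatest_equality) simp_all
  finally have "m_star \<beta> p = g" .
  with \<open>g \<in> M\<close> show "m_star \<beta> p \<in> {0..1}"
    and "\<And>x. x \<in> {0..1} \<Longrightarrow> H \<beta> p x \<le> H \<beta> p (m_star \<beta> p)"
    by (auto simp: M_def)
qed

text \<open>Needed to use \<open>Sup\<close> in \<open>beta_star\<close>. Evaluating at x = 1, where
  H is \<beta> - ln 2, gives the bound ln 2.\<close>

lemma bdd_above_beta_star_set:
  "bdd_above {\<beta>. \<beta> > 0 \<and> (SUP x\<in>{0..1}. H \<beta> p x) = 0}"
proof (rule bdd_aboveI)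
  fix \<beta> assume "\<beta> \<in> {\<beta>. \<beta> > 0 \<and> (SUP x\<in>{0..1}. H \<beta> p x) = 0}"
  then have "H \<beta> p 1 \<le> 0"
    using cSUP_upper[OF _ bdd_above_H, of 1 \<beta> p] by auto
  then show "\<beta> \<le> ln 2" by (simp add: H_def)
qed

text \<open>If 0 were the largest maximizer, the supremum of H would be H at 0, which is 0, so
  \<beta> would belong to the set whose supremum is \<open>beta_star p\<close>.\<close>

lemma m_star_pos:
  assumes "p \<ge> 2" "\<beta> > 0" "beta_star p < \<beta>"
  shows "m_star \<beta> p > 0"
proof (rule ccontr)
  assume "\<not> m_star \<beta> p > 0"
  then have "m_star \<beta> p = 0" using m_star_maximizer(1)[of \<beta> p] by auto
  then have "H \<beta> p x \<le> 0" if "x \<in> {0..1}" for x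
    using m_star_maximizer(2)[OF that, of \<beta> p] H_0 assms(1) by simp
  then have "(SUP x\<in>{0..1}. H \<beta> p x) = 0"
    using H_0[OF assms(1), of \<beta>] by (intro cSup_eq_maximum) (force intro: rev_image_eqI)+
  then have "\<beta> \<le> beta_star p"
    unfolding beta_star_def using assms(2) by (intro cSup_upper bdd_above_beta_star_set) simp
  with assms(3) show False by simp
qed

text \<open>The entropy has infinite slope at 1 while \<beta> x^p has finite slope, so moving
  slightly left of 1 increases H.\<close>

lemma m_star_less_1:
  assumes "p \<ge> 2" "\<beta> > 0"
  shows "m_star \<beta> p < 1"
proof (rule ccontr)
  assume "\<not> m_star \<beta> p < 1"
  then have m: "m_star \<beta> p = 1" using m_star_maximizer(1)[of \<beta> p] by auto
  (* chosen so that - t * ln t / 2, the entropy gain at 1 - t, equals the Bernoulli bound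
     \<beta> * p * t on the loss *)
  define t where "t = exp (- (2 * \<beta> * p))"
  have t: "0 < t" "t < 1" "ln t = - (2 * \<beta> * p)" using assms by (auto simp: t_def)
  have "\<beta> * (1 - p * t) \<le> \<beta> * (1 - t) ^ p"
    using Bernoulli_inequality[of "-t" p] t assms by (intro mult_left_mono) auto
  moreover have "(2 - t) * ln (2 - t) \<le> (2 - t) * ln 2"
    using t by (intro mult_left_mono) auto
  moreover have "t * ln t = - (2 * (\<beta> * (p * t)))" using t by simp
  \<comment> \<open>Once the loss and the gain cancel, t ln 2 / 2 remains as a lower bound for H at
    1 - t minus H at 1; this makes the comparison strict.\<close>
  moreover have "t * ln 2 > 0" using t by simp
  moreover have "H \<beta> p (1 - t) = \<beta> * (1 - t) ^ p - 1/2 * ((2 - t) * ln (2 - t) + t * ln t)"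
    by (simp add: H_def)
  moreover have "H \<beta> p 1 = \<beta> - ln 2" by (simp add: H_def)
  ultimately have "H \<beta> p (1 - t) > H \<beta> p 1" by (simp add: algebra_simps)
  then show False using m_star_maximizer(2)[of "1 - t" \<beta> p] m t by simp
qed

lemma DERIV_H:
  assumes "0 < x" "x < 1"
  shows "(H \<beta> p has_real_derivative \<beta> * (p * x ^ (p - 1)) - artanh x) (at x)"
proof -
  have "((\<lambda>x. (1 + x) * ln (1 + x)) has_real_derivative ln (1 + x) + 1) (at x)"
    using assms by (auto intro!: derivative_eq_intros)
  moreover have "((\<lambda>x. (1 - x) * ln (1 - x)) has_real_derivative - ln (1 - x) - 1) (at x)"
    using assms by (auto intro!: derivative_eq_intros)
  ultimately have "((\<lambda>x. \<beta> * x ^ p - 1/2 * ((1 + x) * ln (1 + x) + (1 - x) * ln (1 - x)))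
      has_real_derivative \<beta> * (p * x ^ (p - 1))
        - 1/2 * ((ln (1 + x) + 1) + (- ln (1 - x) - 1))) (at x)"
    using DERIV_pow[of p x UNIV]
    by (intro DERIV_diff DERIV_cmult DERIV_add) simp_all
  moreover have "artanh x = 1/2 * ((ln (1 + x) + 1) + (- ln (1 - x) - 1))"
    using assms by (simp add: artanh_def ln_div)
  ultimately show ?thesis unfolding H_def by metis
qed

lemma m_star_critical:
  assumes "p \<ge> 2" "\<beta> > 0" "beta_star p < \<beta>"
  shows "\<beta> * (p * m_star \<beta> p ^ (p - 1)) = artanh (m_star \<beta> p)"
proof -
  let ?m = "m_star \<beta> p"
  have m: "0 < ?m" "?m < 1" using m_star_pos m_star_less_1 assms by auto
  have "\<beta> * (p * ?m ^ (p - 1)) - artanh ?m = 0"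
  proof (rule DERIV_local_max[OF DERIV_H[OF m]])
    \<comment> \<open>This radius keeps the neighbourhood inside [0,1], where \<open>?m\<close> is
      known to be a maximizer.\<close>
    show "0 < min ?m (1 - ?m)" using m by simp
    show "\<forall>y. \<bar>?m - y\<bar> < min ?m (1 - ?m) \<longrightarrow> H \<beta> p y \<le> H \<beta> p ?m"
      by (auto intro!: m_star_maximizer(2))
  qed
  then show ?thesis by simp
qed

text \<open>For 0 < p < q, the positive solution m of p m^(p-1) = q m^(q-1).\<close>

definition common_critical_point :: "nat \<Rightarrow> nat \<Rightarrow> real" where
  "common_critical_point p q = root (q - p) (p / q)"

definition coincidence_beta :: "nat \<Rightarrow> nat \<Rightarrow> real" where
  "coincidence_beta p q =
    (let m = common_critical_point p q in artanh m / (p * m ^ (p - 1)))"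

lemma coincidence_beta_unique:
  assumes "p \<in> L \<beta>" "q \<in> L \<beta>" "p < q" "\<beta> > 0" "m_star \<beta> q = m_star \<beta> p"
  shows "\<beta> = coincidence_beta p q"
proof -
  let ?m = "m_star \<beta> p"
  have pq: "p \<ge> 2" "q \<ge> 2" "beta_star p < \<beta>" "beta_star q < \<beta>"
    using assms by (auto simp: L_def)
  have m: "?m > 0" using m_star_pos pq assms by auto
  have crit: "\<beta> * (p * ?m ^ (p - 1)) = artanh ?m"
    using m_star_critical pq assms by simp
  moreover have "\<beta> * (q * ?m ^ (q - 1)) = artanh ?m"
    using m_star_critical[of q \<beta>] pq assms by simp
  ultimately have "p * ?m ^ (p - 1) = q * ?m ^ (q - 1)"
    using assms(4) by (metis less_irrefl mult_cancel_left)
  also have "?m ^ (q - 1) = ?m ^ (q - p) * ?m ^ (p - 1)"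
    using assms(3) pq by (simp flip: power_add)
  \<comment> \<open>Positivity of \<open>?m\<close> allows cancelling \<open>?m ^ (p - 1)\<close>,
    and below it singles out the positive root.\<close>
  finally have "?m ^ (q - p) = p / q" using m pq by (simp add: field_simps)
  then have "?m = common_critical_point p q"
    using m assms(3) unfolding common_critical_point_def
    by (metis less_imp_le real_root_power_cancel zero_less_diff)
  with crit m pq show ?thesis
    by (simp add: coincidence_beta_def Let_def field_simps)
qed

theorem proposition3:
  shows "\<exists>\<Xi> :: real set. countable \<Xi> \<and> \<Xi> \<subseteq> {0<..} \<and> (\<forall>\<beta> \<in> {0<..} - \<Xi>. L1 \<beta> = {})"
proof (intro exI conjI ballI)
  let ?\<Xi> = "range (\<lambda>(p, q). coincidence_beta p q) \<inter> {0<..}"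
  show "countable ?\<Xi>" by auto
  show "?\<Xi> \<subseteq> {0<..}" by auto
  fix \<beta> :: real assume \<beta>: "\<beta> \<in> {0<..} - ?\<Xi>"
  show "L1 \<beta> = {}"
  proof (rule ccontr)
    assume "L1 \<beta> \<noteq> {}"
    then obtain p q where "p \<in> L \<beta>" "q \<in> L \<beta>" "q \<noteq> p" "m_star \<beta> q = m_star \<beta> p"
      unfolding L1_def by auto
    \<comment> \<open>The coincidence is symmetric in p and q, but \<open>coincidence_beta\<close>
      expects the smaller exponent first.\<close>
    with \<beta> have "\<beta> = coincidence_beta p q \<or> \<beta> = coincidence_beta q p"
      using coincidence_beta_unique[of p \<beta> q] coincidence_beta_unique[of q \<beta> p]
      by (cases "p < q") auto
    with \<beta> show False by (auto simp: image_iff)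
  qed
qed

end
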